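(* Let $n\geq 3$ and let $M$ be a connected holomorphic h-umbilical hypersurface in $(\mathbb{R}^{2n+2},g,J)$. Then $M$ is contained in an h-sphere or in a holomorphic hyperplane.
   Context: On $\mathbb{R}^{2n+2}$ with points $Z=(x^1,\dots,x^{n+1};y^1,\dots,y^{n+1})$, let $J(x;y)=(y;-x)$, $g(Z,W)=\sum_k x_Z^kx_W^k-\sum_k y_Z^ky_W^k$, $\tilde g(Z,W)=g(JZ,W)$; this is a flat Kähler manifold with Norden metric ($g(JZ,JW)=-g(Z,W)$, $\nabla'J=0$ for the flat connection $\nabla'$). A holomorphic hypersurface is a $2n$-dimensional submanifold $M$ with $J(T_pM)=T_pM$ and $g|_{T_pM}$ nondegenerate for all $p$; with induced Levi-Civita connection $\nabla$, its second fundamental form $\sigma$ is defined by $\nabla'_XY=\nabla_XY+\sigma(X,Y)$, and its mean curvature vector is $H=\frac{1}{2n}\operatorname{trace}_g\sigma$. $M$ is h-umbilical if at every point $\sigma(x,y)=g(x,y)H-\tilde g(x,y)JH$ for all tangent $x,y$. For $z_0$ with position vector $Z_0$ and $(a,b)\neq(0,0)$, the h-sphere $S^{2n}(z_0;a,b)=\{Z: g(Z-Z_0,Z-Z_0)=a,\ \tilde g(Z-Z_0,Z-Z_0)=b\}$. A holomorphic hyperplane is an affine subspace $Z_0+W$ with $W$ a $J$-invariant $2n$-dimensional linear subspace on which $g$ is nondegenerate. *)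

theory Defs
  imports "HOL-Analysis.Analysis"
begin

text \<open>Ambient space R^(2n+2) with points Z = (x;y), x,y in R^(n+1); the index type 'm has CARD('m) = n+1.\<close>

type_synonym 'm pt = "(real^'m) \<times> (real^'m)"

definition Jm :: "'m::finite pt \<Rightarrow> 'm pt" where
  "Jm z = (snd z, - fst z)"

definition gN :: "'m::finite pt \<Rightarrow> 'm pt \<Rightarrow> real" where
  "gN z w = fst z \<bullet> fst w - snd z \<bullet> snd w"

definition gT :: "'m::finite pt \<Rightarrow> 'm pt \<Rightarrow> real" where
  "gT z w = gN (Jm z) w"

fun ddir :: "('a::real_normed_vector \<Rightarrow> 'b::real_normed_vector) \<Rightarrow> 'a list \<Rightarrow> 'a \<Rightarrow> 'b" where
  "ddir f [] = f"
| "ddir f (v # vs) = (\<lambda>x. frechet_derivative (ddir f vs) (at x) v)"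

definition smooth_on :: "'a::real_normed_vector set \<Rightarrow> ('a \<Rightarrow> 'b::real_normed_vector) \<Rightarrow> bool" where
  "smooth_on S f \<longleftrightarrow> open S \<and> (\<forall>vs. \<forall>x\<in>S. ddir f vs differentiable (at x))"

definition codim2_submanifold :: "'m::finite pt set \<Rightarrow> bool" where
  "codim2_submanifold M \<longleftrightarrow>
     (\<forall>p\<in>M. \<exists>V (F :: 'm pt \<Rightarrow> real \<times> real).
        p \<in> V \<and> smooth_on V F \<and>
        (\<forall>q\<in>M \<inter> V. surj (frechet_derivative F (at q))) \<and>
        M \<inter> V = {q\<in>V. F q = 0})"

definition tangent_space :: "'m::finite pt set \<Rightarrow> 'm pt \<Rightarrow> 'm pt set" where
  "tangent_space M p = {v. \<exists>(\<gamma>::real \<Rightarrow> 'm pt) e. e > 0 \<and> (\<forall>t\<in>{-e<..<e}. \<gamma> t \<in> M) \<and>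
        \<gamma> 0 = p \<and> (\<gamma> has_vector_derivative v) (at 0)}"

definition g_nondegenerate_on :: "'m::finite pt set \<Rightarrow> bool" where
  "g_nondegenerate_on W \<longleftrightarrow> (\<forall>w\<in>W. (\<forall>u\<in>W. gN w u = 0) \<longrightarrow> w = 0)"

definition holomorphic_hypersurface :: "'m::finite pt set \<Rightarrow> bool" where
  "holomorphic_hypersurface M \<longleftrightarrow> codim2_submanifold M \<and>
     (\<forall>p\<in>M. Jm ` tangent_space M p = tangent_space M p \<and> g_nondegenerate_on (tangent_space M p))"

definition nor_proj :: "'m::finite pt set \<Rightarrow> 'm pt \<Rightarrow> 'm pt \<Rightarrow> 'm pt" where
  "nor_proj M p v = (THE w. (\<forall>u\<in>tangent_space M p. gN w u = 0) \<and> v - w \<in> tangent_space M p)"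

definition tan_proj :: "'m::finite pt set \<Rightarrow> 'm pt \<Rightarrow> 'm pt \<Rightarrow> 'm pt" where
  "tan_proj M p v = v - nor_proj M p v"

text \<open>Second fundamental form sigma(x,y) at p: normal part of the flat derivative nabla'_x Y, where
  Y is the tangent vector field q |-> tan_proj M q y extending y (Gauss formula).\<close>

definition sff :: "'m::finite pt set \<Rightarrow> 'm pt \<Rightarrow> 'm pt \<Rightarrow> 'm pt \<Rightarrow> 'm pt" where
  "sff M p x y = nor_proj M p (frechet_derivative (\<lambda>q. tan_proj M q y) (at p within M) x)"

definition g_trace :: "'m::finite pt set \<Rightarrow> ('m pt \<Rightarrow> 'm pt \<Rightarrow> 'm pt) \<Rightarrow> 'm pt" where
  "g_trace T B = (SOME t. \<exists>es. set es \<subseteq> T \<and> span (set es) = T \<and> length es = dim T \<and>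
      (\<forall>i<length es. \<forall>j<length es. i \<noteq> j \<longrightarrow> gN (es!i) (es!j) = 0) \<and>
      (\<forall>i<length es. gN (es!i) (es!i) = 1 \<or> gN (es!i) (es!i) = -1) \<and>
      t = (\<Sum>i<length es. gN (es!i) (es!i) *\<^sub>R B (es!i) (es!i)))"

definition mean_curv :: "'m::finite pt set \<Rightarrow> 'm pt \<Rightarrow> 'm pt" where
  "mean_curv M p = (1 / (2 * (real CARD('m) - 1))) *\<^sub>R g_trace (tangent_space M p) (sff M p)"

definition h_umbilical :: "'m::finite pt set \<Rightarrow> bool" where
  "h_umbilical M \<longleftrightarrow> (\<forall>p\<in>M. \<forall>x\<in>tangent_space M p. \<forall>y\<in>tangent_space M p.
     sff M p x y = gN x y *\<^sub>R mean_curv M p - gT x y *\<^sub>R Jm (mean_curv M p))"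

definition h_sphere :: "'m::finite pt \<Rightarrow> real \<Rightarrow> real \<Rightarrow> 'm pt set" where
  "h_sphere Z0 a b = {Z. gN (Z - Z0) (Z - Z0) = a \<and> gT (Z - Z0) (Z - Z0) = b}"

definition holomorphic_hyperplane :: "'m::finite pt set \<Rightarrow> bool" where
  "holomorphic_hyperplane P \<longleftrightarrow> (\<exists>Z0 W. subspace W \<and> Jm ` W \<subseteq> W \<and>
      dim W = 2 * (CARD('m) - 1) \<and> g_nondegenerate_on W \<and> P = (\<lambda>w. Z0 + w) ` W)"

end

theory Submission
  imports Defs
begin

text \<open>Identify the ambient space with a complex vector space on which \<open>J\<close> is multiplication by \<open>-\<i>\<close>;
  then \<open>g + \<i> g~\<close> is a complex bilinear form, and the tangent spaces are the complex hyperplanes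
  orthogonal to a local normal field \<open>\<nu>\<close> with \<open>\<langle>\<nu>, \<nu>\<rangle> = 1\<close>. The h-umbilical condition says that
  the derivative of \<open>\<nu>\<close> on tangent vectors is multiplication by a complex number \<open>-\<lambda>\<close> with \<open>H = \<lambda> \<nu>\<close>.
  Writing the hypersurface as a graph over a tangent space shows that \<open>\<lambda>\<close> is locally constant, whence
  \<open>\<nu> + \<lambda> Z\<close> is locally constant. The globally defined quantity \<open>\<langle>H, H\<rangle> = \<lambda>\<^sup>2\<close> is therefore constant on a
  connected hypersurface: if it is nonzero, the centre \<open>Z + H / \<lambda>\<^sup>2\<close> is constant and the
  hypersurface lies on an h-sphere; if it is zero, all affine tangent spaces coincide.\<close>

section \<open>Complex scalars and the complex bilinear form\<close>

text \<open>The minus sign lets \<i> act as \<open>- Jm\<close>, the usual multiplication in the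
  coordinates x + \<i> y. With the opposite sign \<open>cform\<close> would be
  conjugate-linear.\<close>

definition cscale :: "complex \<Rightarrow> 'm::finite pt \<Rightarrow> 'm pt" where
  "cscale c z = Re c *\<^sub>R z - Im c *\<^sub>R Jm z"

text \<open>In the coordinates x + \<i> y this is the dot product without conjugation.\<close>

definition cform :: "'m::finite pt \<Rightarrow> 'm pt \<Rightarrow> complex" where
  "cform z w = Complex (gN z w) (gT z w)"

lemma bounded_bilinear_cscale: "bounded_bilinear (cscale :: complex \<Rightarrow> 'm::finite pt \<Rightarrow> 'm pt)"
  unfolding bilinear_conv_bounded_bilinear[symmetric] bilinear_def cscale_def Jm_def
  by (auto intro!: linearI simp: algebra_simps prod_eq_iff scaleR_conv_of_real)

lemma bounded_bilinear_cform: "bounded_bilinear (cform :: 'm::finite pt \<Rightarrow> _)"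
  unfolding bilinear_conv_bounded_bilinear[symmetric] bilinear_def cform_def gT_def gN_def Jm_def
  by (auto intro!: linearI simp: algebra_simps complex_eq_iff)

interpretation cscale: bounded_bilinear "cscale :: complex \<Rightarrow> 'm::finite pt \<Rightarrow> 'm pt"
  by (rule bounded_bilinear_cscale)

interpretation cform: bounded_bilinear "cform :: 'm::finite pt \<Rightarrow> 'm pt \<Rightarrow> complex"
  by (rule bounded_bilinear_cform)

lemma cscale_cscale [simp]: "cscale c (cscale d z) = cscale (c * d) z"
  by (simp add: cscale_def Jm_def prod_eq_iff algebra_simps)

lemma cscale_one [simp]: "cscale 1 z = z"
  by (simp add: cscale_def)

lemma cform_commute: "cform z w = cform w z"
  by (simp add: cform_def gT_def gN_def Jm_def inner_commute)

lemma cform_cscale_left [simp]: "cform (cscale c z) w = c * cform z w"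
  by (simp add: cform_def cscale_def gT_def gN_def Jm_def complex_eq_iff algebra_simps)

lemma cform_cscale_right [simp]: "cform z (cscale c w) = c * cform z w"
  by (metis cform_cscale_left cform_commute)

lemma Re_cform: "Re (cform z w) = gN z w" and Im_cform: "Im (cform z w) = gT z w"
  by (simp_all add: cform_def)

text \<open>Flipping the sign of the second block of the test vector turns \<open>gN\<close> into
  the Euclidean square norm.\<close>

lemma gN_nondegenerate: "z = 0" if "\<And>w. gN z w = 0"
proof -
  have "gN z (fst z, - snd z) = 0" by (rule that)
  then have "fst z \<bullet> fst z + snd z \<bullet> snd z = 0" by (simp add: gN_def)
  then have "fst z = 0 \<and> snd z = 0"
    by (metis add_nonneg_eq_0_iff inner_eq_zero_iff inner_ge_zero)
  then show ?thesis by (simp add: prod_eq_iff)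
qed

text \<open>By nondegeneracy some \<open>w\<close> has a nonzero value, and its complex multiples
  reach every other value.\<close>

lemma surj_cform:
  assumes "a \<noteq> 0"
  shows "surj (cform a)"
proof -
  obtain w where "cform a w \<noteq> 0"
    using assms gN_nondegenerate Re_cform by (metis zero_complex.simps(1))
  then have "cform a (cscale (c / cform a w) w) = c" for c by simp
  then show ?thesis unfolding surj_def by metis
qed

section \<open>Kernels of linear maps\<close>

text \<open>The kernel is the orthogonal complement of the range of the adjoint, and the adjoint of
  a surjective map is injective.\<close>

lemma dim_kernel_surj:
  fixes f :: "'a::euclidean_space \<Rightarrow> 'b::euclidean_space"
  assumes "linear f" "surj f"
  shows "dim {x. f x = 0} + DIM('b) = DIM('a)"
proof -
  have *: "x \<bullet> adjoint f y = f x \<bullet> y" for x y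
    using adjoint_works[OF assms(1)] by (simp add: inner_commute)
  have lin: "linear (adjoint f)" using adjoint_linear assms(1) by blast
  have "inj (adjoint f)"
    unfolding linear_injective_0[OF lin]
  proof (intro allI impI)
    fix y assume "adjoint f y = 0"
    then have "f x \<bullet> y = 0" for x using *[of x y] by simp
    then have "y \<bullet> y = 0" using assms(2) by (metis surjD)
    then show "y = 0" by simp
  qed
  then have "dim (range (adjoint f)) = DIM('b)"
    using dim_image_eq[OF lin, of UNIV] by (simp add: lin dim_UNIV)
  moreover have "{x. f x = 0} = {x \<in> UNIV. \<forall>y\<in>range (adjoint f). orthogonal y x}"
    by (auto simp: orthogonal_def inner_commute[of "adjoint f _"] *)
  moreover have "dim {x \<in> UNIV. \<forall>y\<in>range (adjoint f). orthogonal y x}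
      + dim (range (adjoint f)) = dim (UNIV :: 'a set)"
    by (rule dim_subspace_orthogonal_to_vectors)
       (auto intro: linear_subspace_image lin)
  ultimately show ?thesis by simp
qed

lemma ker_nontrivial:
  fixes f :: "'a::euclidean_space \<Rightarrow> 'b::euclidean_space"
  assumes "linear f" "DIM('b) < DIM('a)"
  obtains x where "x \<noteq> 0" "f x = 0"
proof -
  have "\<not> inj f"
  proof
    assume "inj f"
    then have "dim (range f) = DIM('a)"
      using dim_image_eq[OF assms(1), of UNIV] by (simp add: dim_UNIV)
    then show False using dim_subset_UNIV[of "range f"] assms(2) by simp
  qed
  then show ?thesis using linear_injective_0[OF assms(1)] that by blast
qed

section \<open>Smooth maps and level sets as graphs\<close>

lemma smooth_on_has_derivative:
  "smooth_on V F \<Longrightarrow> q \<in> V \<Longrightarrow> (F has_derivative frechet_derivative F (at q)) (at q)"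
  unfolding smooth_on_def by (metis ddir.simps(1) frechet_derivative_works)

text \<open>This is the one-element list in \<open>ddir\<close>. It supplies the continuity of the
  derivative for the inverse function theorem and, later, the differentiability of the normal
  field.\<close>

lemma smooth_on_differentiable_deriv:
  assumes "smooth_on V F" "q \<in> V"
  shows "(\<lambda>x. frechet_derivative F (at x) v) differentiable (at q)"
proof -
  have "ddir F [v] differentiable (at q)" using assms unfolding smooth_on_def by blast
  then show ?thesis by simp
qed

lemma smooth_on_subset: "smooth_on V F \<Longrightarrow> open U \<Longrightarrow> U \<subseteq> V \<Longrightarrow> smooth_on U F"
  unfolding smooth_on_def by blast

text \<open>The chart \<open>q \<mapsto> P (q - p) + (1 - P) (S (F q))\<close>, with \<open>S\<close> a right inverse of the derivative of
  \<open>F\<close> at \<open>p\<close>, has derivative the identity at \<open>p\<close>; its local inverse is the graph parametrization.\<close>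

lemma level_set_graph:
  fixes F :: "'a::euclidean_space \<Rightarrow> 'b::euclidean_space"
  assumes smooth: "smooth_on V F" and p: "p \<in> V" "F p = 0"
    and surj: "surj (frechet_derivative F (at p))"
    and P: "linear P" "range P = {v. frechet_derivative F (at p) v = 0}"
      "\<And>v. P (P v) = P v"
  obtains \<rho> \<phi> U where "\<rho> > 0" "open U" "p \<in> U" "\<phi> 0 = p"
    "\<phi> ` (range P \<inter> ball 0 \<rho>) = U \<inter> {q\<in>V. F q = 0}"
    "\<And>u. u \<in> range P \<inter> ball 0 \<rho> \<Longrightarrow> P (\<phi> u - p) = u"
    "\<And>u. u \<in> ball 0 \<rho> \<Longrightarrow> \<phi> differentiable at u"
proof -
  define D where "D q = frechet_derivative F (at q)" for q
  have D: "(F has_derivative D q) (at q)" if "q \<in> V" for q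
    unfolding D_def using smooth_on_has_derivative[OF smooth that] .
  have linD: "linear (D q)" if "q \<in> V" for q
    using D[OF that] has_derivative_linear by blast
  have "open V" using smooth by (simp add: smooth_on_def)
  obtain S where S: "linear S" "\<And>r. D p (S r) = r"
    using linear_surjective_right_inverse[OF linD[OF p(1)]] surj
    unfolding D_def by (metis comp_apply id_apply)
  \<comment> \<open>Removing the \<open>P\<close> part of \<open>S\<close> keeps it a right inverse
    of \<open>D p\<close>, now with values in the kernel of \<open>P\<close>.\<close>
  define R where "R r = S r - P (S r)" for r
  have linR: "linear R"
    unfolding R_def using S(1) P(1) by (intro linear_compose_sub) (auto intro: linear_compose[unfolded o_def])
  have PR: "P (R r) = 0" for r
    by (simp add: R_def linear_diff[OF P(1)] P(3))
  have Pker: "P v = v \<longleftrightarrow> D p v = 0" for v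
    using P(2,3) unfolding D_def by (metis (mono_tags, lifting) mem_Collect_eq rangeE rangeI)
  have DP: "D p (P v) = 0" for v using Pker P(3) by blast
  have DR: "D p (R r) = r" for r
    by (simp add: R_def linear_diff[OF linD[OF p(1)]] S DP)
  have RD: "R (D p v) = v - P v" for v
  proof -
    have "D p (S (D p v) - v) = 0" by (simp add: linear_diff[OF linD[OF p(1)]] S)
    then have "P (S (D p v) - v) = S (D p v) - v" using Pker by blast
    then show ?thesis by (simp add: R_def linear_diff[OF P(1)] algebra_simps)
  qed
  define \<Psi> where "\<Psi> q = P (q - p) + R (F q)" for q
  define \<Psi>' where "\<Psi>' q = Blinfun (\<lambda>v. P v + R (D q v))" for q
  have bl: "bounded_linear (\<lambda>v. P v + R (D q v))" if "q \<in> V" for q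
    using P(1) linR linD[OF that]
    by (auto simp: linear_conv_bounded_linear intro!: bounded_linear_add bounded_linear_compose[of R])
  have \<Psi>': "blinfun_apply (\<Psi>' q) v = P v + R (D q v)" if "q \<in> V" for q v
    unfolding \<Psi>'_def using bounded_linear_Blinfun_apply[OF bl[OF that]] by simp
  have der: "(\<Psi> has_derivative blinfun_apply (\<Psi>' q)) (at q)" if "q \<in> V" for q
  proof -
    have "((\<lambda>q. P (q - p) + R (F q)) has_derivative (\<lambda>v. P (v - 0) + R (D q v))) (at q)"
      using linR P(1) unfolding linear_conv_bounded_linear
      by (intro derivative_intros bounded_linear.has_derivative[of P] bounded_linear.has_derivative[of R]
          D that)
    then show ?thesis by (simp add: \<Psi>_def[abs_def] \<Psi>'[OF that, abs_def])
  qed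
  \<comment> \<open>Continuity in operator norm reduces to continuity on each basis vector, where
    second-order smoothness of \<open>F\<close> applies.\<close>
  have cont: "continuous_on V \<Psi>'"
  proof (rule continuous_on_blinfun_componentwise)
    fix i :: 'a
    have "continuous_on V (\<lambda>q. D q i)"
      unfolding D_def
      by (intro continuous_at_imp_continuous_on ballI differentiable_imp_continuous_within
          smooth_on_differentiable_deriv[OF smooth])
    then have "continuous_on V (\<lambda>q. P i + R (D q i))"
      using linR unfolding linear_conv_bounded_linear
      by (intro continuous_on_add continuous_on_const bounded_linear.continuous_on[of R])
    then show "continuous_on V (\<lambda>q. blinfun_apply (\<Psi>' q) i)"
      by (rule continuous_on_eq) (simp add: \<Psi>')
  qed
  have inv: "id_blinfun o\<^sub>L \<Psi>' p = id_blinfun"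
    by (rule blinfun_eqI) (simp add: \<Psi>' p RD)
  obtain U W \<phi> \<phi>' where U: "open U" "U \<subseteq> V" "p \<in> U" "open W" "\<Psi> p \<in> W"
    and hom: "homeomorphism U W \<Psi> \<phi>"
    and \<phi>: "\<And>y. y \<in> W \<Longrightarrow> (\<phi> has_derivative (\<phi>' y)) (at y)"
    by (rule inverse_function_theorem[OF \<open>open V\<close> der cont p(1) inv]) (assumption, rule that)
  have \<Psi>p: "\<Psi> p = 0" by (simp add: \<Psi>_def p linear_0[OF linR] linear_0[OF P(1)])
  then obtain \<rho> where \<rho>: "\<rho> > 0" "ball 0 \<rho> \<subseteq> W" using U(4,5) open_contains_ball by metis
  define U' where "U' = U \<inter> \<Psi> -` ball 0 \<rho>"
  have "open U'"
    unfolding U'_def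
    by (rule continuous_open_preimage[OF _ U(1) open_ball]) (use hom homeomorphism_cont1 in blast)
  \<comment> \<open>\<open>D p\<close> kills the \<open>P\<close> part of \<open>\<Psi> q\<close>
    and undoes \<open>R\<close>, so \<open>D p (\<Psi> q) = F q\<close>: the chart straightens the
    level set to the kernel of \<open>D p\<close>.\<close>
  have F0: "F q = 0 \<longleftrightarrow> \<Psi> q \<in> range P" for q
  proof
    assume "F q = 0" then show "\<Psi> q \<in> range P" by (simp add: \<Psi>_def linear_0[OF linR])
  next
    assume "\<Psi> q \<in> range P"
    then have "D p (\<Psi> q) = 0" using DP by auto
    then show "F q = 0" by (simp add: \<Psi>_def linear_add[OF linD[OF p(1)]] DP DR)
  qed
  have mem: "\<phi> u \<in> U" "\<Psi> (\<phi> u) = u" if "u \<in> ball 0 \<rho>" for u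
  proof -
    have "u \<in> W" using that \<rho>(2) by blast
    then show "\<phi> u \<in> U" "\<Psi> (\<phi> u) = u"
      using homeomorphism_image2[OF hom] homeomorphism_apply2[OF hom] by auto
  qed
  have \<phi>\<Psi>: "\<phi> (\<Psi> q) = q" if "q \<in> U" for q
    using homeomorphism_apply1[OF hom that] .
  show thesis
  proof
    show "\<rho> > 0" by fact
    show "open U'" by fact
    show "p \<in> U'" using U(3) \<Psi>p \<rho>(1) by (simp add: U'_def)
    show "\<phi> 0 = p" using \<phi>\<Psi>[OF U(3)] \<Psi>p by simp
    show "\<phi> ` (range P \<inter> ball 0 \<rho>) = U' \<inter> {q\<in>V. F q = 0}"
    proof (intro equalityI subsetI)
      fix q assume "q \<in> \<phi> ` (range P \<inter> ball 0 \<rho>)"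
      then obtain u where u: "u \<in> range P" "u \<in> ball 0 \<rho>" "q = \<phi> u" by blast
      then show "q \<in> U' \<inter> {q\<in>V. F q = 0}"
        using mem[OF u(2)] F0[of q] U(2) by (auto simp: U'_def)
    next
      fix q assume "q \<in> U' \<inter> {q\<in>V. F q = 0}"
      then have "q = \<phi> (\<Psi> q)" "\<Psi> q \<in> range P \<inter> ball 0 \<rho>"
        using \<phi>\<Psi> F0[of q] by (auto simp: U'_def)
      then show "q \<in> \<phi> ` (range P \<inter> ball 0 \<rho>)" by blast
    qed
    show "P (\<phi> u - p) = u" if u: "u \<in> range P \<inter> ball 0 \<rho>" for u
    proof -
      have "P (\<Psi> (\<phi> u)) = P (\<phi> u - p)"
        by (simp add: \<Psi>_def linear_add[OF P(1)] PR P(3))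
      then show ?thesis using mem(2) u P(3) by auto
    qed
    show "\<phi> differentiable at u" if "u \<in> ball 0 \<rho>" for u
      using \<phi> that \<rho>(2) unfolding differentiable_def by blast
  qed
qed

section \<open>Tangent vectors and derivatives within the submanifold\<close>

lemma tangent_spaceE:
  assumes "v \<in> tangent_space M p"
  obtains \<gamma> e where "e > 0" "\<And>t. \<bar>t\<bar> < e \<Longrightarrow> \<gamma> t \<in> M" "\<gamma> 0 = p" "(\<gamma> has_vector_derivative v) (at 0)"
proof -
  from assms obtain \<gamma> e where "e > 0" "\<forall>t\<in>{-e<..<e}. \<gamma> t \<in> M" "\<gamma> 0 = p" "(\<gamma> has_vector_derivative v) (at 0)"
    unfolding tangent_space_def by blast
  then show thesis by (intro that[of e \<gamma>]) (auto simp: abs_less_iff)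
qed

lemma tangent_spaceI:
  assumes "e > 0" "\<And>t. \<bar>t\<bar> < e \<Longrightarrow> \<gamma> t \<in> M" "\<gamma> 0 = p" "(\<gamma> has_vector_derivative v) (at 0)"
  shows "v \<in> tangent_space M p"
  unfolding tangent_space_def using assms by (auto intro!: exI[of _ \<gamma>] exI[of _ e])

lemma has_derivative_within_curve:
  assumes "(f has_derivative f') (at p within M)" and "e > 0" "\<And>t. \<bar>t\<bar> < e \<Longrightarrow> \<gamma> t \<in> M"
    "\<gamma> 0 = p" "(\<gamma> has_vector_derivative v) (at 0)"
  shows "((\<lambda>t. f (\<gamma> t)) has_vector_derivative f' v) (at (0::real))"
proof -
  define I where "I = {-e<..<e}"
  have I: "open I" "0 \<in> I" using assms(2) by (auto simp: I_def)
  have 1: "(\<gamma> has_derivative (\<lambda>t. t *\<^sub>R v)) (at 0 within I)"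
    using assms(5) by (simp add: has_vector_derivative_def has_derivative_at_withinI)
  have "\<gamma> ` I \<subseteq> M" using assms(3) by (auto simp: I_def)
  then have "(f has_derivative f') (at (\<gamma> 0) within \<gamma> ` I)"
    using assms(1,4) has_derivative_subset by blast
  from diff_chain_within[OF 1 this]
  have "((f \<circ> \<gamma>) has_derivative (f' \<circ> (\<lambda>t. t *\<^sub>R v))) (at 0)"
    unfolding at_within_open[OF I(2,1)] .
  moreover have "f' \<circ> (\<lambda>t. t *\<^sub>R v) = (\<lambda>t. t *\<^sub>R f' v)"
    using has_derivative_linear[OF assms(1)] by (auto simp: linear_cmul)
  ultimately show ?thesis by (simp add: has_vector_derivative_def o_def)
qed

text \<open>A derivative within \<open>M\<close> need not be unique, so
  \<open>frechet_derivative\<close> is an arbitrary choice there. On a tangent vector all choices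
  agree, since each is the velocity of \<open>f\<close> along the same curve in \<open>M\<close>.
  This makes \<open>sff\<close> computable.\<close>

lemma frechet_derivative_within_tangent:
  assumes "(f has_derivative f') (at p within M)" "x \<in> tangent_space M p"
  shows "frechet_derivative f (at p within M) x = f' x"
proof -
  obtain \<gamma> e where \<gamma>: "e > 0" "\<And>t. \<bar>t\<bar> < e \<Longrightarrow> \<gamma> t \<in> M" "\<gamma> 0 = p" "(\<gamma> has_vector_derivative x) (at 0)"
    using tangent_spaceE[OF assms(2)] by metis
  have "(f has_derivative frechet_derivative f (at p within M)) (at p within M)"
    using assms(1) frechet_derivative_works unfolding differentiable_def by metis
  from has_derivative_within_curve[OF this \<gamma>] has_derivative_within_curve[OF assms(1) \<gamma>]
  show ?thesis by (rule vector_derivative_unique_at)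
qed

lemma has_derivative_within_transform_open:
  assumes "(f has_derivative f') (at p within M)" "open U" "p \<in> M \<inter> U"
    "\<And>q. q \<in> M \<inter> U \<Longrightarrow> f q = g q"
  shows "(g has_derivative f') (at p within M)"
  using assms(1)
proof (rule has_derivative_transform_eventually)
  show "\<forall>\<^sub>F q in at p within M. f q = g q"
    unfolding eventually_at_topological using assms(2-4) by blast
qed (use assms in auto)

text \<open>Within \<open>M\<close> both \<open>f'\<close> and the zero map are derivatives of
  \<open>f\<close> at \<open>p\<close>, and these agree on tangent vectors.\<close>

lemma locally_constant_tangent_derivative:
  assumes "(f has_derivative f') (at p)" "x \<in> tangent_space M p" "open U" "p \<in> U"
    "\<And>q. q \<in> M \<inter> U \<Longrightarrow> f q = c"
  shows "f' x = 0"
proof -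
  have "p \<in> M" using assms(2) by (auto elim!: tangent_spaceE)
  have "(f has_derivative (\<lambda>v. 0)) (at p within M)"
    by (rule has_derivative_within_transform_open[where U=U and f="\<lambda>q. c"])
      (use assms \<open>p \<in> M\<close> in auto)
  with frechet_derivative_within_tangent[OF this assms(2)]
    frechet_derivative_within_tangent[OF has_derivative_at_withinI[OF assms(1)] assms(2)]
  show ?thesis by simp
qed

text \<open>Tangent vectors lie in the kernel because \<open>F\<close> vanishes on \<open>M\<close>
  near \<open>p\<close>. Conversely, the graph parametrization lifts the line through
  \<open>v\<close> to a curve in \<open>M\<close>. Its velocity \<open>w\<close> lies in the kernel,
  hence is fixed by the projection \<open>P\<close>, while the projected curve has velocity
  \<open>v\<close>; so \<open>w = v\<close>.\<close>

lemma tangent_space_level_set: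
  fixes F :: "'m::finite pt \<Rightarrow> 'b::euclidean_space"
  assumes smooth: "smooth_on V F" and p: "p \<in> M" "p \<in> V"
    and surj: "surj (frechet_derivative F (at p))" and M: "M \<inter> V = {q\<in>V. F q = 0}"
  shows "tangent_space M p = {v. frechet_derivative F (at p) v = 0}" (is "_ = {v. ?D v = 0}")
proof (intro equalityI subsetI)
  have "open V" using smooth by (simp add: smooth_on_def)
  have D: "(F has_derivative ?D) (at p)"
    by (rule smooth_on_has_derivative[OF smooth p(2)])
  {
    fix v assume "v \<in> tangent_space M p"
    with locally_constant_tangent_derivative[OF D this \<open>open V\<close> p(2), of 0] M
    show "v \<in> {v. ?D v = 0}" by auto
  }
  have lin: "linear ?D" using D has_derivative_linear by blast
  obtain S where S: "linear S" "\<And>r. ?D (S r) = r"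
    using linear_surjective_right_inverse[OF lin surj] by (metis comp_apply id_apply)
  define P where "P v = v - S (?D v)" for v
  have P: "linear P"
    unfolding P_def using S(1) lin
    by (intro linear_compose_sub) (auto intro: linear_compose[unfolded o_def] simp: linear_id[unfolded id_def])
  have DP: "?D (P v) = 0" for v by (simp add: P_def linear_diff[OF lin] S)
  have Pker: "P v = v" if "?D v = 0" for v by (simp add: P_def that linear_0[OF S(1)])
  have ran: "range P = {v. ?D v = 0}" using DP Pker by (auto simp: image_iff) metis
  have "F p = 0" using p M by blast
  obtain \<rho> \<phi> U where \<phi>: "\<rho> > 0" "open U" "p \<in> U" "\<phi> 0 = p"
    "\<phi> ` (range P \<inter> ball 0 \<rho>) = U \<inter> {q\<in>V. F q = 0}"
    "\<And>u. u \<in> range P \<inter> ball 0 \<rho> \<Longrightarrow> P (\<phi> u - p) = u"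
    "\<And>u. u \<in> ball 0 \<rho> \<Longrightarrow> \<phi> differentiable at u"
    by (rule level_set_graph[OF smooth p(2) \<open>F p = 0\<close> surj P ran Pker[OF DP]]) (rule that)
  fix v assume "v \<in> {v. ?D v = 0}"
  then have v: "v \<in> range P" using ran by simp
  \<comment> \<open>The added 1 keeps the quotient meaningful for \<open>v = 0\<close>.\<close>
  define e where "e = \<rho> / (norm v + 1)"
  have e: "e > 0" using \<phi>(1) by (simp add: e_def add_nonneg_pos)
  have tv: "t *\<^sub>R v \<in> range P \<inter> ball 0 \<rho>" if "\<bar>t\<bar> < e" for t
  proof -
    have "norm (t *\<^sub>R v) \<le> \<bar>t\<bar> * (norm v + 1)" by (simp add: algebra_simps)
    also have "\<dots> < \<rho>" using that by (simp add: e_def pos_less_divide_eq add_nonneg_pos)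
    finally show ?thesis using v P by (auto simp: linear_subspace_image subspace_scale)
  qed
  obtain \<phi>' where \<phi>': "(\<phi> has_derivative \<phi>') (at 0)"
    using \<phi>(7)[of 0] \<phi>(1) by (auto simp: differentiable_def)
  define w where "w = \<phi>' v"
  have \<gamma>: "((\<lambda>t. \<phi> (t *\<^sub>R v)) has_vector_derivative w) (at 0)"
    unfolding w_def
    by (rule has_derivative_within_curve[where M=UNIV and e=1 and p=0])
      (auto intro!: derivative_eq_intros \<phi>')
  have \<gamma>M: "\<phi> (t *\<^sub>R v) \<in> M" if "\<bar>t\<bar> < e" for t
    using tv[OF that] \<phi>(5) M by blast
  have w: "w \<in> tangent_space M p"
    by (rule tangent_spaceI[OF e \<gamma>M _ \<gamma>]) (simp_all add: \<phi>)
  then have "?D w = 0"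
    using locally_constant_tangent_derivative[OF D w \<open>open V\<close> p(2), of 0] M by auto
  then have "P w = w" by (rule Pker)
  have "((\<lambda>t. P (\<phi> (t *\<^sub>R v) - p)) has_vector_derivative P (w - 0)) (at 0)"
    using P \<gamma> unfolding linear_conv_bounded_linear
    by (intro bounded_linear.has_vector_derivative[of P] derivative_intros)
  moreover have "((\<lambda>t. P (\<phi> (t *\<^sub>R v) - p)) has_vector_derivative v) (at 0)"
    by (rule has_vector_derivative_transform_within_open[where S="{-e<..<e}" and f="\<lambda>t. t *\<^sub>R v"])
      (use e \<phi>(6)[OF tv] in \<open>auto intro!: derivative_eq_intros simp: abs_less_iff\<close>)
  ultimately have "P (w - 0) = v" by (rule vector_derivative_unique_at)
  then show "v \<in> tangent_space M p" using w \<open>P w = w\<close> by simp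
qed

section \<open>Unit normal fields\<close>

lemma differentiable_bounded_linear:
  "bounded_linear f \<Longrightarrow> g differentiable F \<Longrightarrow> (\<lambda>x. f (g x)) differentiable F"
  unfolding differentiable_def using bounded_linear.has_derivative by blast

lemma differentiable_bounded_bilinear:
  assumes "bounded_bilinear B" "f differentiable (at x within S)" "g differentiable (at x within S)"
  shows "(\<lambda>x. B (f x) (g x)) differentiable (at x within S)"
  using assms(2,3) bounded_bilinear.FDERIV[OF assms(1)] unfolding differentiable_def by blast

text \<open>The conditions fix \<open>\<nu>\<close> up to sign. The factor \<open>l\<close> with
  \<open>H = l \<nu>\<close> then has the same ambiguity, but its square does not.\<close>

definition unit_normal :: "'m::finite pt set \<Rightarrow> 'm pt \<Rightarrow> 'm pt \<Rightarrow> bool" where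
  "unit_normal M q \<nu> \<longleftrightarrow> cform \<nu> \<nu> = 1 \<and> tangent_space M q = {v. cform \<nu> v = 0}"

text \<open>Every vector is a complex multiple of \<open>\<nu>\<close> plus an element of the
  hyperplane, and \<open>d\<close> is orthogonal to both parts.\<close>

lemma cform_ker_nondegenerate:
  assumes \<nu>: "cform \<nu> \<nu> = 1" and d: "cform \<nu> d = 0"
    and orth: "\<And>u. cform \<nu> u = 0 \<Longrightarrow> gN d u = 0"
  shows "d = 0"
proof (rule gN_nondegenerate)
  fix v
  define u where "u = v - cscale (cform v \<nu>) \<nu>"
  have "cform \<nu> u = 0" using \<nu> by (simp add: u_def cform.diff_right cform_commute)
  then have "Re (cform d u) = 0" using orth by (simp add: Re_cform)
  moreover have "cform d u = cform d v" using d by (simp add: u_def cform.diff_right cform_commute)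
  ultimately show "gN d v = 0" by (simp add: Re_cform)
qed

text \<open>The normal space is the complex line of \<open>\<nu>\<close>, so the definite
  description becomes a formula that can be differentiated. Two candidates differ by a tangent
  vector orthogonal to all tangent vectors, which vanishes.\<close>

lemma nor_proj_unit_normal:
  assumes "unit_normal M q \<nu>"
  shows "nor_proj M q v = cscale (cform v \<nu>) \<nu>"
  unfolding nor_proj_def
proof (rule the_equality)
  have \<nu>: "cform \<nu> \<nu> = 1" and T: "tangent_space M q = {v. cform \<nu> v = 0}"
    using assms by (auto simp: unit_normal_def)
  have mem: "cform \<nu> (v - cscale (cform v \<nu>) \<nu>) = 0"
    using \<nu> by (simp add: cform.diff_right cform_commute)
  have orth: "gN (cscale c \<nu>) u = 0" if "u \<in> tangent_space M q" for c u
    using that by (simp add: T flip: Re_cform)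
  show "(\<forall>u\<in>tangent_space M q. gN (cscale (cform v \<nu>) \<nu>) u = 0)
      \<and> v - cscale (cform v \<nu>) \<nu> \<in> tangent_space M q"
    using orth mem T by simp
  fix w assume w: "(\<forall>u\<in>tangent_space M q. gN w u = 0) \<and> v - w \<in> tangent_space M q"
  have "w - cscale (cform v \<nu>) \<nu> = 0"
  proof (rule cform_ker_nondegenerate[OF \<nu>])
    have "cform \<nu> (v - cscale (cform v \<nu>) \<nu>) - cform \<nu> (v - w) = 0"
      using mem w T by simp
    then show "cform \<nu> (w - cscale (cform v \<nu>) \<nu>) = 0" by (simp add: cform.diff_right)
    fix u assume "cform \<nu> u = 0"
    then have "u \<in> tangent_space M q" using T by simp
    then have "gN w u = 0" "gN (cscale (cform v \<nu>) \<nu>) u = 0" using w orth by blast+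
    then show "gN (w - cscale (cform v \<nu>) \<nu>) u = 0"
      by (simp add: cform.diff_left flip: Re_cform)
  qed
  then show "w = cscale (cform v \<nu>) \<nu>" by simp
qed

text \<open>Invariance under \<open>Jm\<close> gives \<open>gT a v = gN a (Jm v) = 0\<close> on
  \<open>T\<close>, so \<open>T\<close> lies in the kernel of \<open>cform a\<close>; both have real
  codimension 2. If \<open>cform a a\<close> were 0, then \<open>a\<close> would be a nonzero vector
  of \<open>T\<close> orthogonal to \<open>T\<close>.\<close>

lemma complex_hyperplane_eq_ker:
  fixes L :: "'m::finite pt \<Rightarrow> real \<times> real"
  assumes L: "linear L" "surj L" and T: "T = {v. L v = 0}"
    and J: "Jm ` T = T" and nondeg: "g_nondegenerate_on T" and a: "\<And>v. gN a v = fst (L v)"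
  shows "cform a a \<noteq> 0" "T = {v. cform a v = 0}"
proof -
  have lin: "linear (cform a)" using cform.bounded_linear_right bounded_linear.linear by blast
  have "a \<noteq> 0"
  proof
    assume "a = 0"
    then have "fst (L v) = 0" for v using a[of v] by (simp add: gN_def)
    moreover obtain v where "L v = (1, 0)" using L(2) by (metis surjD)
    ultimately show False by (metis fst_conv zero_neq_one)
  qed
  have sub: "T \<subseteq> {v. cform a v = 0}"
  proof
    fix v assume v: "v \<in> T"
    have "Jm v \<in> T" using J v by blast
    then have "gN a (Jm v) = 0" "gN a v = 0" using v T a by auto
    moreover have "gT a v = gN a (Jm v)" by (simp add: gT_def gN_def Jm_def)
    ultimately show "v \<in> {v. cform a v = 0}" by (simp add: cform_def complex_eq_iff)
  qed
  show T': "T = {v. cform a v = 0}"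
  proof (rule subspace_dim_equal)
    show "subspace T" unfolding T using L(1) by (rule linear_subspace_kernel)
    show "subspace {v. cform a v = 0}" using lin by (rule linear_subspace_kernel)
    show "dim {v. cform a v = 0} \<le> dim T"
      using dim_kernel_surj[OF L] dim_kernel_surj[OF lin surj_cform[OF \<open>a \<noteq> 0\<close>]] T by simp
  qed (fact sub)
  show "cform a a \<noteq> 0"
  proof
    assume "cform a a = 0"
    then have "a \<in> T" using T' by simp
    moreover have "\<forall>u\<in>T. gN a u = 0" using a T by simp
    ultimately show False using nondeg \<open>a \<noteq> 0\<close> unfolding g_nondegenerate_on_def by blast
  qed
qed

text \<open>The gradient of the first component of \<open>F\<close> with respect to
  \<open>gN\<close> is a complex normal; dividing it by a local square root of its
  \<open>cform\<close> square normalises it.\<close>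

lemma hypersurface_local_unit_normal:
  fixes M :: "'m::finite pt set"
  assumes M: "holomorphic_hypersurface M" and p: "p \<in> M"
  obtains U and F :: "'m pt \<Rightarrow> real \<times> real" and \<nu> where "p \<in> U" "smooth_on U F" "M \<inter> U = {q\<in>U. F q = 0}"
    "\<And>q. q \<in> M \<inter> U \<Longrightarrow> surj (frechet_derivative F (at q))"
    "\<And>q. q \<in> U \<Longrightarrow> \<nu> differentiable (at q)"
    "\<And>q. q \<in> M \<inter> U \<Longrightarrow> unit_normal M q (\<nu> q)"
proof -
  have "codim2_submanifold M" using M by (simp add: holomorphic_hypersurface_def)
  from bspec[OF this[unfolded codim2_submanifold_def] p]
  obtain V and F :: "'m pt \<Rightarrow> real \<times> real" where V: "p \<in> V" "smooth_on V F"
    "\<forall>q\<in>M \<inter> V. surj (frechet_derivative F (at q))" "M \<inter> V = {q\<in>V. F q = 0}"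
    by (elim exE conjE)
  have "open V" using V(2) by (simp add: smooth_on_def)
  define D where "D q = frechet_derivative F (at q)" for q
  have linD: "linear (D q)" if "q \<in> V" for q
    unfolding D_def using smooth_on_has_derivative[OF V(2) that] has_derivative_linear by blast
  \<comment> \<open>Flipping the second block of a basis vector \<open>b\<close> gives the vector
    whose \<open>gN\<close> product with \<open>v\<close> is the coordinate
    \<open>v \<bullet> b\<close>, so \<open>a q\<close> represents
    \<open>fst (D q v)\<close>.\<close>
  define a where "a q = (\<Sum>b\<in>Basis. fst (D q b) *\<^sub>R (fst b, - snd b))" for q
  have a: "gN (a q) v = fst (D q v)" if "q \<in> V" for q v
  proof -
    have lin: "linear (\<lambda>w. gN w v)" by (rule linearI) (simp_all add: gN_def algebra_simps)
    have "gN (a q) v = (\<Sum>b\<in>Basis. fst (D q b) * gN (fst b, - snd b) v)"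
      unfolding a_def linear_sum[OF lin] linear_cmul[OF lin] by simp
    also have "\<dots> = (\<Sum>b\<in>Basis. fst (D q b) * (v \<bullet> b))"
      by (simp add: gN_def inner_prod_def inner_commute)
    also have "\<dots> = fst (\<Sum>b\<in>Basis. (v \<bullet> b) *\<^sub>R D q b)"
      by (simp add: fst_sum mult.commute)
    also have "(\<Sum>b\<in>Basis. (v \<bullet> b) *\<^sub>R D q b) = D q (\<Sum>b\<in>Basis. (v \<bullet> b) *\<^sub>R b)"
      by (simp only: linear_sum[OF linD[OF that]] linear_cmul[OF linD[OF that]])
    finally show ?thesis by (simp add: euclidean_representation)
  qed
  have a_ker: "cform (a q) (a q) \<noteq> 0" "tangent_space M q = {v. cform (a q) v = 0}" if q: "q \<in> M \<inter> V" for q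
  proof -
    have T: "tangent_space M q = {v. D q v = 0}"
      unfolding D_def using q by (intro tangent_space_level_set[OF V(2)] bspec[OF V(3)] V(4)) auto
    have "Jm ` tangent_space M q = tangent_space M q" "g_nondegenerate_on (tangent_space M q)"
      using M q unfolding holomorphic_hypersurface_def by auto
    note * = complex_hyperplane_eq_ker[OF linD _ T this a]
    show "cform (a q) (a q) \<noteq> 0" "tangent_space M q = {v. cform (a q) v = 0}"
      using * bspec[OF V(3) q] q by (auto simp: D_def)
  qed
  \<comment> \<open>Scaling by \<open>c\<close> makes \<open>h p = 1\<close>, so near
    \<open>p\<close> the values of \<open>h\<close> avoid the branch cut of
    \<open>csqrt\<close>.\<close>
  define c where "c = 1 / cform (a p) (a p)"
  define h where "h q = c * cform (a q) (a q)" for q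
  define U where "U = V \<inter> h -` (- \<real>\<^sub>\<le>\<^sub>0)"
  have a_diff: "a differentiable (at q)" if "q \<in> V" for q
    unfolding a_def D_def
    by (intro differentiable_sum differentiable_scaleR differentiable_const finite_Basis ballI
        differentiable_bounded_linear[OF bounded_linear_fst] smooth_on_differentiable_deriv[OF V(2) that])
  have h_diff: "h differentiable (at q)" if "q \<in> V" for q
    unfolding h_def
    by (intro differentiable_mult differentiable_const a_diff that
        differentiable_bounded_bilinear[OF bounded_bilinear_cform])
  have "open U"
    unfolding U_def
    by (intro continuous_open_preimage continuous_at_imp_continuous_on ballI
        differentiable_imp_continuous_within h_diff \<open>open V\<close>) auto
  \<comment> \<open>The square of the scalar factor is \<open>c / h q\<close>, the inverse of
    \<open>cform (a q) (a q)\<close>.\<close>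
  define \<nu> where "\<nu> q = cscale (csqrt c / csqrt (h q)) (a q)" for q
  show thesis
  proof
    have "h p = 1" using a_ker(1)[of p] p V(1) by (simp add: h_def c_def)
    then show "p \<in> U" using V(1) by (simp add: U_def)
    show "smooth_on U F" using V(2) \<open>open U\<close> by (rule smooth_on_subset) (simp add: U_def)
    show "M \<inter> U = {q\<in>U. F q = 0}" using V(4) by (auto simp: U_def)
    show "surj (frechet_derivative F (at q))" if "q \<in> M \<inter> U" for q
      using V(3) that by (simp add: U_def)
    show "\<nu> differentiable (at q)" if "q \<in> U" for q
    proof -
      have q: "q \<in> V" "h q \<notin> \<real>\<^sub>\<le>\<^sub>0" using that by (auto simp: U_def)
      then have "csqrt (h q) \<noteq> 0" by auto
      have "csqrt differentiable (at (h q))"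
        using has_field_derivative_csqrt[OF q(2)] unfolding differentiable_def has_field_derivative_def by blast
      then have "(\<lambda>q. csqrt (h q)) differentiable (at q)"
        using differentiable_chain_at[OF h_diff[OF q(1)]] by (simp add: o_def)
      then have "(\<lambda>q. csqrt c / csqrt (h q)) differentiable (at q)"
        using \<open>csqrt (h q) \<noteq> 0\<close> by (intro differentiable_divide differentiable_const)
      then show ?thesis
        unfolding \<nu>_def by (rule differentiable_bounded_bilinear[OF bounded_bilinear_cscale _ a_diff[OF q(1)]])
    qed
    show "unit_normal M q (\<nu> q)" if "q \<in> M \<inter> U" for q
    proof -
      have q: "q \<in> M \<inter> V" "h q \<noteq> 0" using that by (auto simp: U_def)
      have "c \<noteq> 0" using \<open>h p = 1\<close> by (auto simp: h_def)
      have "cform (\<nu> q) (\<nu> q) = (csqrt c)\<^sup>2 * cform (a q) (a q) / (csqrt (h q))\<^sup>2"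
        by (simp add: \<nu>_def power2_eq_square)
      also have "\<dots> = 1" using q(2) by (simp add: h_def)
      finally show ?thesis
        using a_ker(2)[OF q(1)] \<open>c \<noteq> 0\<close> q(2) by (simp add: unit_normal_def \<nu>_def)
    qed
  qed
qed

section \<open>The Weingarten equation\<close>

text \<open>Differentiating \<open>cform \<nu> \<nu> = 1\<close> shows that \<open>\<nu>' x\<close>
  is tangent. Comparing two expressions for \<open>sff\<close> gives
  \<open>cform y (\<nu>' x) = - l * cform x y\<close> for all tangent \<open>y\<close>, and
  nondegeneracy on the tangent space identifies \<open>\<nu>' x\<close>.\<close>

lemma unit_normal_umbilical_derivative:
  fixes M :: "'m::finite pt set"
  assumes card: "CARD('m) \<ge> 2" and umb: "h_umbilical M" and U: "open U" "p \<in> M \<inter> U"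
    and \<nu>': "(\<nu> has_derivative \<nu>') (at p)" and un: "\<And>q. q \<in> M \<inter> U \<Longrightarrow> unit_normal M q (\<nu> q)"
  defines "l \<equiv> cform (mean_curv M p) (\<nu> p)"
  shows "mean_curv M p = cscale l (\<nu> p)"
    and "\<And>x. x \<in> tangent_space M p \<Longrightarrow> \<nu>' x = - cscale l x"
proof -
  let ?T = "tangent_space M p" and ?H = "mean_curv M p"
  have \<nu>: "cform (\<nu> p) (\<nu> p) = 1" and T: "?T = {v. cform (\<nu> p) v = 0}"
    using un[OF U(2)] by (auto simp: unit_normal_def)
  have tan: "cform (\<nu> p) (\<nu>' x) = 0" if x: "x \<in> ?T" for x
  proof -
    have "((\<lambda>q. cform (\<nu> q) (\<nu> q)) has_derivative (\<lambda>h. cform (\<nu> p) (\<nu>' h) + cform (\<nu>' h) (\<nu> p))) (at p)"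
      by (intro cform.FDERIV \<nu>')
    then have "cform (\<nu> p) (\<nu>' x) + cform (\<nu>' x) (\<nu> p) = 0"
      by (rule locally_constant_tangent_derivative[where c=1, OF _ x U(1)])
        (use U un in \<open>auto simp: unit_normal_def\<close>)
    then show ?thesis by (simp add: cform_commute)
  qed
  \<comment> \<open>The field to differentiate is \<open>y - cscale (cform y \<nu>) \<nu>\<close>.
    As \<open>cform y (\<nu> p) = 0\<close>, only the term along \<open>\<nu> p\<close> survives,
    and it is already normal.\<close>
  have sff: "sff M p x y = - cscale (cform y (\<nu>' x)) (\<nu> p)" if x: "x \<in> ?T" and y: "y \<in> ?T" for x y
  proof -
    have "((\<lambda>q. y - cscale (cform y (\<nu> q)) (\<nu> q)) has_derivative
        (\<lambda>h. 0 - (cscale (cform y (\<nu> p)) (\<nu>' h) + cscale (cform y (\<nu>' h)) (\<nu> p)))) (at p within M)"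
      by (intro has_derivative_diff has_derivative_const cscale.FDERIV
          bounded_linear.has_derivative[OF cform.bounded_linear_right] has_derivative_at_withinI[OF \<nu>'])
    then have "((\<lambda>q. tan_proj M q y) has_derivative
        (\<lambda>h. 0 - (cscale (cform y (\<nu> p)) (\<nu>' h) + cscale (cform y (\<nu>' h)) (\<nu> p)))) (at p within M)"
      by (rule has_derivative_within_transform_open[OF _ U])
        (simp add: tan_proj_def nor_proj_unit_normal[OF un])
    from frechet_derivative_within_tangent[OF this x]
    have "frechet_derivative (\<lambda>q. tan_proj M q y) (at p within M) x = - cscale (cform y (\<nu>' x)) (\<nu> p)"
      using y T by (simp add: cform_commute[of y] cscale.zero_left)
    then show ?thesis
      using \<nu> unfolding sff_def
      by (simp add: nor_proj_unit_normal[OF un[OF U(2)]] cform.minus_left cscale.minus_left)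
  qed
  \<comment> \<open>The two real terms of the umbilical condition are one complex multiple of
    \<open>?H\<close>.\<close>
  have eq: "- cscale (cform y (\<nu>' x)) (\<nu> p) = cscale (cform x y) ?H" if "x \<in> ?T" "y \<in> ?T" for x y
    using umb U(2) that sff[OF that] unfolding h_umbilical_def
    by (simp add: cscale_def[of "cform x y"] Re_cform Im_cform)
  \<comment> \<open>That \<open>?H\<close> is a multiple of \<open>\<nu> p\<close> is read off from
    \<open>eq\<close> at a tangent pair with \<open>cform\<close> equal to 1; such a pair exists
    because the tangent space is nonzero.\<close>
  have "linear (cform (\<nu> p))" using cform.bounded_linear_right bounded_linear.linear by blast
  then obtain d where d: "d \<noteq> 0" "cform (\<nu> p) d = 0"
    by (rule ker_nontrivial) (use card in auto)
  then obtain u where u: "cform (\<nu> p) u = 0" "gN d u \<noteq> 0"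
    using cform_ker_nondegenerate[OF \<nu> d(2)] by blast
  then have "cform d u \<noteq> 0" by (metis Re_cform zero_complex.simps(1))
  then have "cform d (cscale (1 / cform d u) u) = 1" by simp
  then have "?H = - cscale (cform (cscale (1 / cform d u) u) (\<nu>' d)) (\<nu> p)"
    using eq[of d "cscale (1 / cform d u) u"] d(2) u(1) T by simp
  then obtain k where k: "?H = cscale k (\<nu> p)" by (metis cscale.minus_left)
  then have "l = k" using \<nu> by (simp add: l_def)
  then show H: "?H = cscale l (\<nu> p)" using k by simp
  fix x assume x: "x \<in> ?T"
  have "\<nu>' x + cscale l x = 0"
  proof (rule cform_ker_nondegenerate[OF \<nu>])
    show "cform (\<nu> p) (\<nu>' x + cscale l x) = 0"
      using tan[OF x] x T by (simp add: cform.add_right)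
    fix y assume "cform (\<nu> p) y = 0"
    then have "y \<in> ?T" using T by simp
    from arg_cong[OF eq[OF x this], of "cform (\<nu> p)"]
    have "cform y (\<nu>' x) + l * cform x y = 0"
      using \<nu> by (simp add: H cform.minus_right mult.commute add_eq_0_iff)
    then have "cform (\<nu>' x + cscale l x) y = 0" by (simp add: cform.add_left cform_commute[of y])
    then show "gN (\<nu>' x + cscale l x) y = 0" by (metis Re_cform zero_complex.simps(1))
  qed
  then show "\<nu>' x = - cscale l x" by (simp add: eq_neg_iff_add_eq_0)
qed

section \<open>Constancy of the conformal factor\<close>

lemma zero_vector_derivative_imp_eq:
  assumes "\<And>t. t \<in> {0..1} \<Longrightarrow> (f has_vector_derivative 0) (at t)"
  shows "f 1 = f (0::real)"
proof -
  have "\<exists>c. \<forall>t\<in>{0..1}. f t = c"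
    by (rule has_derivative_zero_constant[OF convex_real_interval(5)])
      (use assms in \<open>simp add: has_vector_derivative_def has_derivative_at_withinI\<close>)
  then show ?thesis by force
qed

lemma has_vector_derivative_line:
  assumes "(f has_derivative f') (at (u + t *\<^sub>R x))"
  shows "((\<lambda>t. f (u + t *\<^sub>R x)) has_vector_derivative f' x) (at t)"
proof -
  have "((\<lambda>t. u + t *\<^sub>R x) has_vector_derivative x) (at t)"
    by (auto intro!: derivative_eq_intros)
  then have "((\<lambda>t. u + t *\<^sub>R x) has_derivative (\<lambda>s. s *\<^sub>R x)) (at t)"
    by (simp add: has_vector_derivative_def)
  from has_derivative_compose[OF this assms] show ?thesis
    using has_derivative_linear[OF assms] by (simp add: has_vector_derivative_def linear_cmul)
qed

text \<open>For \<open>e\<close> orthogonal to \<open>u\<close> the function \<open>cform (m \<cdot>) e\<close> is constant in direction \<open>u\<close>, so its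
  derivatives at \<open>0\<close> and at \<open>u\<close> in a direction \<open>x\<close> not orthogonal to \<open>e\<close> agree; this replaces
  the Codazzi equation and needs only one derivative of \<open>m\<close>.\<close>

lemma complex_conformal_factor_constant:
  fixes \<nu> :: "'m::finite pt" and m :: "'m pt \<Rightarrow> 'm pt"
  assumes card: "CARD('m) \<ge> 3" and \<nu>: "cform \<nu> \<nu> = 1"
    and der: "\<And>u x t. cform \<nu> u = 0 \<Longrightarrow> cform \<nu> x = 0 \<Longrightarrow> u + t *\<^sub>R x \<in> ball 0 \<rho> \<Longrightarrow>
      ((\<lambda>t. m (u + t *\<^sub>R x)) has_vector_derivative cscale (l (u + t *\<^sub>R x)) x) (at t)"
    and u: "cform \<nu> u = 0" "u \<in> ball 0 \<rho>"
  shows "l u = l 0"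
proof -
  \<comment> \<open>These are four real equations in at least six real unknowns.\<close>
  have "linear (\<lambda>e. (cform \<nu> e, cform u e))"
    by (rule linearI) (simp_all add: cform.add_right cform.scaleR_right)
  then obtain e where e: "e \<noteq> 0" "cform \<nu> e = 0" "cform u e = 0"
    by (rule ker_nontrivial) (use card in \<open>auto simp: zero_prod_def\<close>)
  obtain x where x: "cform \<nu> x = 0" "gN e x \<noteq> 0"
    using cform_ker_nondegenerate[OF \<nu> e(2)] e(1) by blast
  then have xe: "cform x e \<noteq> 0" by (metis Re_cform cform_commute zero_complex.simps(1))
  have f: "((\<lambda>t. cform (m (v + t *\<^sub>R y)) e) has_vector_derivative l (v + t *\<^sub>R y) * cform y e) (at t)"
    if "cform \<nu> v = 0" "cform \<nu> y = 0" "v + t *\<^sub>R y \<in> ball 0 \<rho>" for v y t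
    using bounded_linear.has_vector_derivative[OF cform.bounded_linear_left der[OF that], of e] by simp
  \<comment> \<open>The segment from \<open>v\<close> to \<open>v + u\<close> stays in the ball, and
    the derivative along it contains the factor \<open>cform u e = 0\<close>.\<close>
  have const: "cform (m (v + u)) e = cform (m v) e"
    if "cform \<nu> v = 0" "v \<in> ball 0 \<rho>" "v + u \<in> ball 0 \<rho>" for v
  proof -
    have "v + t *\<^sub>R u \<in> ball 0 \<rho>" if t: "t \<in> {0..1}" for t
    proof -
      have "v + t *\<^sub>R u = (1 - t) *\<^sub>R v + t *\<^sub>R (v + u)" by (simp add: algebra_simps)
      moreover have "(1 - t) *\<^sub>R v + t *\<^sub>R (v + u) \<in> ball 0 \<rho>"
        by (rule convexD[OF convex_ball]) (use t \<open>v \<in> ball 0 \<rho>\<close> \<open>v + u \<in> ball 0 \<rho>\<close> in auto)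
      ultimately show ?thesis by simp
    qed
    then have "((\<lambda>t. cform (m (v + t *\<^sub>R u)) e) has_vector_derivative 0) (at t)" if "t \<in> {0..1}" for t
      using f[OF \<open>cform \<nu> v = 0\<close> u(1), of t] that e(3) by simp
    from zero_vector_derivative_imp_eq[OF this] show ?thesis by simp
  qed
  \<comment> \<open>The times at which \<open>const\<close> may be applied at
    \<open>t *\<^sub>R x\<close>.\<close>
  define N where "N = {t::real. t *\<^sub>R x \<in> ball 0 \<rho> \<and> u + t *\<^sub>R x \<in> ball 0 \<rho>}"
  have "open ((\<lambda>t::real. t *\<^sub>R x) -` ball 0 \<rho> \<inter> (\<lambda>t. u + t *\<^sub>R x) -` ball 0 \<rho>)"
    by (intro open_Int open_vimage open_ball continuous_intros)
  then have N: "open N" by (simp add: N_def vimage_def Collect_conj_eq)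
  have "\<rho> > 0" using u(2) by (metis ball_eq_empty empty_iff not_le)
  then have N0: "0 \<in> N" using u(2) by (simp add: N_def)
  have "((\<lambda>t. cform (m (u + t *\<^sub>R x)) e) has_vector_derivative l u * cform x e) (at 0)"
    using f[OF u(1) x(1), of 0] u(2) by simp
  moreover have "((\<lambda>t. cform (m (u + t *\<^sub>R x)) e) has_vector_derivative l 0 * cform x e) (at 0)"
  proof (rule has_vector_derivative_transform_within_open[OF _ N N0])
    show "((\<lambda>t. cform (m (t *\<^sub>R x)) e) has_vector_derivative l 0 * cform x e) (at 0)"
      using f[OF _ x(1), of 0 0] \<open>\<rho> > 0\<close> by (simp add: cform.zero_right)
    fix t assume "t \<in> N"
    then show "cform (m (t *\<^sub>R x)) e = cform (m (u + t *\<^sub>R x)) e"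
      using const[of "t *\<^sub>R x"] x(1) by (simp add: N_def cform.scaleR_right add.commute)
  qed
  ultimately have "l u * cform x e = l 0 * cform x e" by (rule vector_derivative_unique_at)
  then show ?thesis using xe by simp
qed

section \<open>Local rigidity of h-umbilical hypersurfaces\<close>

text \<open>Everything is phrased through \<open>mean_curv\<close> and \<open>tangent_space\<close>,
  independent of the sign of the local normal, so that the local statements can be joined over a
  connected \<open>M\<close>.\<close>

lemma h_umbilical_locally_constant:
  fixes M :: "'m::finite pt set"
  assumes card: "CARD('m) \<ge> 3" and M: "holomorphic_hypersurface M" and umb: "h_umbilical M"
    and p: "p \<in> M"
  defines "\<kappa> \<equiv> \<lambda>q. cform (mean_curv M q) (mean_curv M q)"
  obtains S where "openin (top_of_set M) S" "p \<in> S" "\<And>q. q \<in> S \<Longrightarrow> \<kappa> q = \<kappa> p"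
    "\<And>q. q \<in> S \<Longrightarrow> \<kappa> p \<noteq> 0 \<Longrightarrow>
      q + cscale (1 / \<kappa> q) (mean_curv M q) = p + cscale (1 / \<kappa> p) (mean_curv M p)"
    "\<And>q. q \<in> S \<Longrightarrow> \<kappa> p = 0 \<Longrightarrow> (+) q ` tangent_space M q = (+) p ` tangent_space M p"
proof -
  obtain U and F :: "'m pt \<Rightarrow> real \<times> real" and \<nu> where U: "p \<in> U" "smooth_on U F" "M \<inter> U = {q\<in>U. F q = 0}"
    "\<And>q. q \<in> M \<inter> U \<Longrightarrow> surj (frechet_derivative F (at q))"
    "\<And>q. q \<in> U \<Longrightarrow> \<nu> differentiable (at q)"
    and un: "\<And>q. q \<in> M \<inter> U \<Longrightarrow> unit_normal M q (\<nu> q)"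
    by (rule hypersurface_local_unit_normal[OF M p]) (rule that)
  have "open U" using U(2) by (simp add: smooth_on_def)
  define l where "l q = cform (mean_curv M q) (\<nu> q)" for q
  have H: "mean_curv M q = cscale (l q) (\<nu> q)"
    and weingarten: "(\<nu> has_derivative \<nu>') (at q) \<Longrightarrow> x \<in> tangent_space M q \<Longrightarrow> \<nu>' x = - cscale (l q) x"
    if q: "q \<in> M \<inter> U" for q \<nu>' x
  proof -
    have card2: "CARD('m) \<ge> 2" using card by simp
    note * = unit_normal_umbilical_derivative[OF card2 umb \<open>open U\<close> q _ un]
    obtain D where "(\<nu> has_derivative D) (at q)"
      using U(5) q unfolding differentiable_def by blast
    then show "mean_curv M q = cscale (l q) (\<nu> q)" unfolding l_def by (rule *(1))
    show "(\<nu> has_derivative \<nu>') (at q) \<Longrightarrow> x \<in> tangent_space M q \<Longrightarrow> \<nu>' x = - cscale (l q) x"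
      unfolding l_def by (rule *(2))
  qed
  have norm: "cform (\<nu> q) (\<nu> q) = 1" and T: "tangent_space M q = {v. cform (\<nu> q) v = 0}"
    if "q \<in> M \<inter> U" for q using un[OF that] by (auto simp: unit_normal_def)
  have pU: "p \<in> M \<inter> U" using p U(1) by simp
  \<comment> \<open>The graph is taken over the tangent space at \<open>p\<close> by projecting
    along \<open>\<nu> p\<close>. This projection is complex linear, so it commutes with the complex
    factor in the Weingarten equation.\<close>
  define P where "P v = v - cscale (cform v (\<nu> p)) (\<nu> p)" for v
  have linP: "linear P"
    by (rule linearI)
      (simp_all add: P_def cform.add_left cform.scaleR_left cscale.add_left cscale.scaleR_left algebra_simps)
  have P_orth: "cform (\<nu> p) (P v) = 0" for v
    using norm[OF pU] by (simp add: P_def cform.diff_right cform_commute)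
  have P_id: "P v = v" if "cform (\<nu> p) v = 0" for v
    using that by (simp add: P_def cform_commute[of v] cscale.zero_left)
  have P_cscale: "P (cscale c v) = cscale c (P v)" for c v
    by (simp add: P_def cscale.diff_right)
  have ranP: "range P = {v. cform (\<nu> p) v = 0}"
    using P_orth P_id by (auto simp: image_iff) metis
  have tan_p: "{v. frechet_derivative F (at p) v = 0} = {v. cform (\<nu> p) v = 0}"
    using T[OF pU] tangent_space_level_set[OF U(2) p U(1) U(4)[OF pU] U(3)] by simp
  have "F p = 0" using p U(1,3) by blast
  obtain \<rho> \<phi> W where \<rho>: "\<rho> > 0" and W: "open W" "p \<in> W" and \<phi>0: "\<phi> 0 = p"
    and img: "\<phi> ` (range P \<inter> ball 0 \<rho>) = W \<inter> {q\<in>U. F q = 0}"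
    and P\<phi>: "\<And>u. u \<in> range P \<inter> ball 0 \<rho> \<Longrightarrow> P (\<phi> u - p) = u"
    and \<phi>_diff: "\<And>u. u \<in> ball 0 \<rho> \<Longrightarrow> \<phi> differentiable at u"
    by (rule level_set_graph[OF U(2,1) \<open>F p = 0\<close> U(4)[OF pU] linP _ P_id[OF P_orth]])
      (simp add: ranP tan_p, rule that)
  have \<phi>M: "\<phi> u \<in> M \<inter> U" if "cform (\<nu> p) u = 0" "u \<in> ball 0 \<rho>" for u
  proof -
    have "\<phi> u \<in> \<phi> ` (range P \<inter> ball 0 \<rho>)" using that ranP by blast
    then show ?thesis unfolding img using U(3) by blast
  qed
  \<comment> \<open>\<open>\<xi>\<close> is the lift of the horizontal direction \<open>x\<close> to
    a tangent vector of the graph.\<close>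
  have line: "\<exists>\<xi>. \<xi> \<in> tangent_space M (\<phi> (u + t *\<^sub>R x)) \<and> P \<xi> = x
      \<and> ((\<lambda>t. \<phi> (u + t *\<^sub>R x)) has_vector_derivative \<xi>) (at t)
      \<and> ((\<lambda>t. \<nu> (\<phi> (u + t *\<^sub>R x))) has_vector_derivative - cscale (l (\<phi> (u + t *\<^sub>R x))) \<xi>) (at t)"
    if u: "cform (\<nu> p) u = 0" and x: "cform (\<nu> p) x = 0" and w: "u + t *\<^sub>R x \<in> ball 0 \<rho>" for u x t
  proof -
    let ?w = "u + t *\<^sub>R x"
    have orth: "cform (\<nu> p) (u + s *\<^sub>R x) = 0" for s
      using u x by (simp add: cform.add_right cform.scaleR_right)
    define N where "N = (\<lambda>s. u + s *\<^sub>R x) -` ball 0 \<rho>"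
    have N: "open N" unfolding N_def by (intro open_vimage open_ball continuous_intros)
    have tN: "t \<in> N" using w by (simp add: N_def)
    obtain \<phi>' where \<phi>': "(\<phi> has_derivative \<phi>') (at ?w)"
      using \<phi>_diff[OF w] unfolding differentiable_def by blast
    have 1: "((\<lambda>t. \<phi> (u + t *\<^sub>R x)) has_vector_derivative \<phi>' x) (at t)"
      by (rule has_vector_derivative_line[OF \<phi>'])
    have "((\<lambda>s. P (\<phi> (u + s *\<^sub>R x) - p)) has_vector_derivative P (\<phi>' x - 0)) (at t)"
      using linP 1 unfolding linear_conv_bounded_linear
      by (intro bounded_linear.has_vector_derivative[of P] has_vector_derivative_diff has_vector_derivative_const)
    moreover have "((\<lambda>s. P (\<phi> (u + s *\<^sub>R x) - p)) has_vector_derivative x) (at t)"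
    proof (rule has_vector_derivative_transform_within_open[OF _ N tN])
      show "((\<lambda>s. u + s *\<^sub>R x) has_vector_derivative x) (at t)"
        by (auto intro!: derivative_eq_intros)
      show "u + s *\<^sub>R x = P (\<phi> (u + s *\<^sub>R x) - p)" if "s \<in> N" for s
        using P\<phi>[of "u + s *\<^sub>R x"] orth that ranP by (simp add: N_def)
    qed
    ultimately have 2: "P (\<phi>' x) = x" using vector_derivative_unique_at by force
    have 3: "\<phi>' x \<in> tangent_space M (\<phi> ?w)"
    proof -
      obtain e where e: "e > 0" "ball t e \<subseteq> N" using N tN open_contains_ball by blast
      have "\<phi> (?w + s *\<^sub>R x) \<in> M" if s: "\<bar>s\<bar> < e" for s
      proof -
        have "t + s \<in> N" using e(2) s by (auto simp: dist_real_def)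
        then have "u + (t + s) *\<^sub>R x \<in> ball 0 \<rho>" by (simp add: N_def)
        with \<phi>M[OF orth this] show ?thesis by (simp add: algebra_simps)
      qed
      moreover have "((\<lambda>s. \<phi> (?w + s *\<^sub>R x)) has_vector_derivative \<phi>' x) (at 0)"
        by (rule has_vector_derivative_line) (use \<phi>' in simp)
      ultimately show ?thesis by (intro tangent_spaceI[OF e(1), where \<gamma>="\<lambda>s. \<phi> (?w + s *\<^sub>R x)"]) auto
    qed
    have q: "\<phi> ?w \<in> M \<inter> U" by (rule \<phi>M[OF orth w])
    obtain \<nu>' where \<nu>': "(\<nu> has_derivative \<nu>') (at (\<phi> ?w))"
      using U(5) q unfolding differentiable_def by blast
    have "((\<lambda>t. \<nu> (\<phi> (u + t *\<^sub>R x))) has_vector_derivative \<nu>' (\<phi>' x)) (at t)"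
      using has_vector_derivative_line[OF has_derivative_compose[OF \<phi>' \<nu>']] .
    then show ?thesis using 1 2 3 weingarten[OF q \<nu>' 3] by (intro exI[of _ "\<phi>' x"]) simp
  qed
  have l_const: "l (\<phi> u) = l p" if "cform (\<nu> p) u = 0" "u \<in> ball 0 \<rho>" for u
  proof -
    \<comment> \<open>Since \<open>P \<xi> = x\<close>, applying \<open>P\<close> to the derivative
      of \<open>\<nu>\<close> along a lifted line gives the multiple \<open>- l\<close> of
      \<open>x\<close> itself, as the constancy lemma requires.\<close>
    have "- l (\<phi> u) = - l (\<phi> 0)"
    proof (rule complex_conformal_factor_constant[OF card norm[OF pU] _ that,
          where m="\<lambda>u. P (\<nu> (\<phi> u))" and l="\<lambda>u. - l (\<phi> u)"])
      fix u x :: "'m pt" and t :: real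
      assume "cform (\<nu> p) u = 0" "cform (\<nu> p) x = 0" "u + t *\<^sub>R x \<in> ball 0 \<rho>"
      from line[OF this] obtain \<xi> where \<xi>: "P \<xi> = x"
        "((\<lambda>t. \<nu> (\<phi> (u + t *\<^sub>R x))) has_vector_derivative - cscale (l (\<phi> (u + t *\<^sub>R x))) \<xi>) (at t)"
        by blast
      from bounded_linear.has_vector_derivative[OF linP[unfolded linear_conv_bounded_linear] \<xi>(2)]
      show "((\<lambda>t. P (\<nu> (\<phi> (u + t *\<^sub>R x)))) has_vector_derivative cscale (- l (\<phi> (u + t *\<^sub>R x))) x) (at t)"
        by (simp add: \<xi>(1) P_cscale linear_neg[OF linP] cscale.minus_left)
    qed
    then show ?thesis using \<phi>0 by simp
  qed
  have seg: "t *\<^sub>R u \<in> ball 0 \<rho>" if "u \<in> ball 0 \<rho>" "t \<in> {0..1}" for t :: real and u :: "'m pt"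
  proof -
    have "norm (t *\<^sub>R u) \<le> norm u" using that by (simp add: mult_left_le_one_le)
    then show ?thesis using that by simp
  qed
  \<comment> \<open>With \<open>l\<close> constant, the derivatives of the two summands along a
    lifted line cancel.\<close>
  have fix_centre: "\<nu> (\<phi> u) + cscale (l p) (\<phi> u) = \<nu> p + cscale (l p) p"
    if u: "cform (\<nu> p) u = 0" "u \<in> ball 0 \<rho>" for u
  proof -
    have "((\<lambda>t. \<nu> (\<phi> (0 + t *\<^sub>R u)) + cscale (l p) (\<phi> (0 + t *\<^sub>R u))) has_vector_derivative 0) (at t)"
      if t: "t \<in> {0..1}" for t
    proof -
      have w: "0 + t *\<^sub>R u \<in> ball 0 \<rho>" using seg[OF u(2) t] by simp
      obtain \<xi> where "((\<lambda>t. \<phi> (0 + t *\<^sub>R u)) has_vector_derivative \<xi>) (at t)"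
        "((\<lambda>t. \<nu> (\<phi> (0 + t *\<^sub>R u))) has_vector_derivative - cscale (l (\<phi> (0 + t *\<^sub>R u))) \<xi>) (at t)"
        using line[OF cform.zero_right u(1) w] by blast
      moreover have "l (\<phi> (0 + t *\<^sub>R u)) = l p"
        by (rule l_const[OF _ w]) (simp add: u cform.scaleR_right)
      ultimately have "((\<lambda>t. \<nu> (\<phi> (0 + t *\<^sub>R u)) + cscale (l p) (\<phi> (0 + t *\<^sub>R u)))
          has_vector_derivative - cscale (l p) \<xi> + cscale (l p) \<xi>) (at t)"
        by (intro has_vector_derivative_add bounded_linear.has_vector_derivative[OF cscale.bounded_linear_right]) auto
      then show ?thesis by simp
    qed
    from zero_vector_derivative_imp_eq[OF this] show ?thesis using \<phi>0 by simp
  qed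
  define S where "S = \<phi> ` (range P \<inter> ball 0 \<rho>)"
  have S: "S = M \<inter> (U \<inter> W)" unfolding S_def img using U(3) by blast
  have \<kappa>: "\<kappa> q = l q * l q" if "q \<in> M \<inter> U" for q
    using norm[OF that] by (simp add: \<kappa>_def H[OF that])
  show thesis
  proof
    show "openin (top_of_set M) S" unfolding S using \<open>open U\<close> W(1) by (simp add: openin_open_Int open_Int)
    show "p \<in> S" using pU W(2) by (simp add: S)
    fix q assume "q \<in> S"
    then obtain u where u: "cform (\<nu> p) u = 0" "u \<in> ball 0 \<rho>" "q = \<phi> u" using ranP by (auto simp: S_def)
    have q: "q \<in> M \<inter> U" using \<open>q \<in> S\<close> S by blast
    have lq: "l q = l p" using l_const u by simp
    show "\<kappa> q = \<kappa> p" by (simp add: \<kappa>[OF q] \<kappa>[OF pU] lq)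
    show "q + cscale (1 / \<kappa> q) (mean_curv M q) = p + cscale (1 / \<kappa> p) (mean_curv M p)" if "\<kappa> p \<noteq> 0"
    proof -
      have l0: "l p \<noteq> 0" using that \<kappa>[OF pU] by auto
      \<comment> \<open>From \<open>H = l \<nu>\<close> and \<open>\<kappa> = l * l\<close> one gets
        \<open>H / \<kappa> = \<nu> / l\<close>.\<close>
      have "r + cscale (1 / \<kappa> r) (mean_curv M r) = cscale (1 / l p) (\<nu> r + cscale (l p) r)"
        if "r \<in> M \<inter> U" "l r = l p" for r
        using that(2) l0 by (simp add: \<kappa>[OF that(1)] H[OF that(1)] cscale.add_right)
      from this[OF q lq] this[OF pU refl] show ?thesis
        using fix_centre[OF u(1,2)] u(3) by simp
    qed
    show "(+) q ` tangent_space M q = (+) p ` tangent_space M p" if "\<kappa> p = 0"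
    proof -
      have l0: "l p = 0" using that \<kappa>[OF pU] by simp
      have \<nu>_const: "\<nu> (\<phi> v) = \<nu> p" if "cform (\<nu> p) v = 0" "v \<in> ball 0 \<rho>" for v
        using fix_centre[OF that] by (simp add: l0 cscale.zero_left)
      \<comment> \<open>The normal is constant along the lifted segment, so its velocity stays
        orthogonal to \<open>\<nu> p\<close>; hence \<open>q - p\<close> is tangent at
        \<open>p\<close>.\<close>
      have "((\<lambda>t. cform (\<nu> p) (\<phi> (0 + t *\<^sub>R u))) has_vector_derivative 0) (at t)"
        if t: "t \<in> {0..1}" for t
      proof -
        have w: "0 + t *\<^sub>R u \<in> ball 0 \<rho>" using seg[OF u(2) t] by simp
        have orth: "cform (\<nu> p) (0 + t *\<^sub>R u) = 0" by (simp add: u cform.scaleR_right)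
        obtain \<xi> where \<xi>: "((\<lambda>t. \<phi> (0 + t *\<^sub>R u)) has_vector_derivative \<xi>) (at t)"
          "\<xi> \<in> tangent_space M (\<phi> (0 + t *\<^sub>R u))"
          using line[OF cform.zero_right u(1) w] by blast
        then have "cform (\<nu> p) \<xi> = 0"
          using T[OF \<phi>M[OF orth w]] \<nu>_const[OF orth w] by simp
        then show ?thesis
          using bounded_linear.has_vector_derivative[OF cform.bounded_linear_right \<xi>(1), of "\<nu> p"] by simp
      qed
      from zero_vector_derivative_imp_eq[OF this]
      have 0: "cform (\<nu> p) (q - p) = 0" using u(3) \<phi>0 by (simp add: cform.diff_right)
      have Tq: "tangent_space M q = {v. cform (\<nu> p) v = 0}"
        using T[OF q] \<nu>_const[OF u(1,2)] u(3) by simp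
      have "(+) r ` {v. cform (\<nu> p) v = 0} = {z. cform (\<nu> p) (z - r) = 0}" for r
      proof (intro equalityI subsetI)
        fix z assume "z \<in> {z. cform (\<nu> p) (z - r) = 0}"
        then show "z \<in> (+) r ` {v. cform (\<nu> p) v = 0}" by (intro image_eqI[of _ _ "z - r"]) auto
      qed auto
      then show ?thesis
        unfolding Tq T[OF pU] using 0 by (auto simp: cform.diff_right)
    qed
  qed
qed

section \<open>From local to global\<close>

lemma openin_locally_constant:
  assumes "connected M" "p \<in> M" "q \<in> M"
    and "\<And>a. a \<in> M \<Longrightarrow> \<exists>S. openin (top_of_set M) S \<and> a \<in> S \<and> (\<forall>x\<in>S. f x = f a)"
  shows "f q = f p"
  using locally_constant_imp_constant[OF assms(1,4)] assms(2,3) unfolding constant_on_def by metis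

lemma holomorphic_hyperplane_tangent_space:
  fixes M :: "'m::finite pt set"
  assumes M: "holomorphic_hypersurface M" and p: "p \<in> M"
  shows "holomorphic_hyperplane ((+) p ` tangent_space M p)"
proof -
  obtain \<nu> where \<nu>: "unit_normal M p \<nu>"
    using hypersurface_local_unit_normal[OF M p] p by (metis IntI)
  then have T: "tangent_space M p = {v. cform \<nu> v = 0}" by (simp add: unit_normal_def)
  have lin: "linear (cform \<nu>)" using cform.bounded_linear_right bounded_linear.linear by blast
  have "\<nu> \<noteq> 0" using \<nu> by (auto simp: unit_normal_def cform.zero_left)
  then have "dim (tangent_space M p) = 2 * (CARD('m) - 1)"
    using dim_kernel_surj[OF lin surj_cform] by (simp add: T)
  moreover have "subspace (tangent_space M p)"
    unfolding T using lin by (rule linear_subspace_kernel)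
  ultimately show ?thesis
    using M p unfolding holomorphic_hyperplane_def holomorphic_hypersurface_def by blast
qed

theorem theorem4p2:
  fixes M :: "'m::finite pt set"
  assumes "CARD('m) \<ge> 4"
    and "connected M"
    and "holomorphic_hypersurface M"
    and "h_umbilical M"
  shows "(\<exists>Z0 a b. (a, b) \<noteq> (0, 0) \<and> M \<subseteq> h_sphere Z0 a b)
       \<or> (\<exists>P. holomorphic_hyperplane P \<and> M \<subseteq> P)"
proof (cases "M = {}")
  case True
  then show ?thesis by (intro disjI1 exI[of _ 0] exI[of _ 1]) auto
next
  case False
  then obtain p where p: "p \<in> M" by blast
  define \<kappa> where "\<kappa> q = cform (mean_curv M q) (mean_curv M q)" for q
  define centre where "centre q = q + cscale (1 / \<kappa> q) (mean_curv M q)" for q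
  have card: "CARD('m) \<ge> 3" using assms(1) by simp
  have loc: "\<exists>S. openin (top_of_set M) S \<and> a \<in> S \<and> (\<forall>q\<in>S. \<kappa> q = \<kappa> a
      \<and> (\<kappa> a \<noteq> 0 \<longrightarrow> centre q = centre a)
      \<and> (\<kappa> a = 0 \<longrightarrow> (+) q ` tangent_space M q = (+) a ` tangent_space M a))" if "a \<in> M" for a
    unfolding centre_def \<kappa>_def
    by (rule h_umbilical_locally_constant[OF card assms(3,4) that]) (intro exI conjI ballI impI)
  \<comment> \<open>Constancy of \<open>\<kappa>\<close> comes first: it puts all points of
    \<open>M\<close> in the same case of \<open>loc\<close>.\<close>
  have \<kappa>: "\<kappa> q = \<kappa> p" if "q \<in> M" for q
    by (rule openin_locally_constant[OF assms(2) p that]) (use loc in meson)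
  show ?thesis
  proof (cases "\<kappa> p = 0")
    case True
    have "(+) q ` tangent_space M q = (+) p ` tangent_space M p" if "q \<in> M" for q
      by (rule openin_locally_constant[OF assms(2) p that]) (use loc \<kappa> True in metis)
    moreover have "q \<in> (+) q ` tangent_space M q" if "q \<in> M" for q
    proof -
      have "0 \<in> tangent_space M q"
        by (rule tangent_spaceI[of 1 "\<lambda>_. q"]) (use that in \<open>auto intro!: derivative_eq_intros\<close>)
      then show ?thesis by force
    qed
    ultimately have "M \<subseteq> (+) p ` tangent_space M p" by blast
    then show ?thesis using holomorphic_hyperplane_tangent_space[OF assms(3) p] by blast
  next
    case False
    have c: "centre q = centre p" if "q \<in> M" for q
      by (rule openin_locally_constant[OF assms(2) p that]) (use loc \<kappa> False in metis)
    \<comment> \<open>As \<open>q - centre p\<close> is \<open>- H / \<kappa>\<close>, its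
      \<open>cform\<close> square is \<open>1 / \<kappa> p\<close>, whose real and imaginary parts
      are the two parameters.\<close>
    have "q \<in> h_sphere (centre p) (Re (1 / \<kappa> p)) (Im (1 / \<kappa> p))" if "q \<in> M" for q
    proof -
      have "q - centre p = - cscale (1 / \<kappa> p) (mean_curv M q)"
        using c[OF that] \<kappa>[OF that] by (simp add: centre_def algebra_simps)
      then have "cform (q - centre p) (q - centre p) = 1 / \<kappa> p * (1 / \<kappa> p * \<kappa> q)"
        by (simp add: cform.minus_left cform.minus_right \<kappa>_def)
      also have "\<dots> = 1 / \<kappa> p" using False by (simp add: \<kappa>[OF that])
      finally show ?thesis by (simp add: h_sphere_def flip: Re_cform Im_cform)
    qed
    moreover have "(Re (1 / \<kappa> p), Im (1 / \<kappa> p)) \<noteq> (0, 0)"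
      using False by (metis complex_eq_iff divide_eq_0_iff one_neq_zero prod.inject zero_complex.simps)
    ultimately show ?thesis by blast
  qed
qed

end
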